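(* Let $n$ be a positive integer. For any permutation $\alpha\in \mathsf{S}_n$ and for any interlocking pair of pointers $p$ and $q$ in $\alpha$, $$\Gamma_n(\mathbf{cds}_{p,q}(\alpha)) = \mathbf{gcds}(\Gamma_n(\alpha),\{p,q\}).$$
   Context: **Permutations and pointers.** $\mathsf{S}_n$ is the set of permutations of $\{1,\dots,n\}$, written as lists $\alpha=[a_1,\dots,a_n]$. An entry $k$ of $\alpha$ has a head pointer $(k,k+1)$, placed immediately to the right of $k$, and a tail pointer $(k-1,k)$, placed immediately to the left of $k$. The pointers $(0,1)$ and $(n,n+1)$ are disregarded, so $\alpha$ has the $n-1$ pointers $(i,i+1)$, $1\le i\le n-1$. Each pointer $(i,i+1)$ occurs exactly twice in $\alpha$: just to the right of $i$ and just to the left of $i+1$. In the gap between two consecutive entries $e,f$ of $\alpha$, the head pointer of $e$ comes before the tail pointer of $f$; thus all occurrences of pointers are linearly ordered from left to right. **Interlocking.** Two distinct pointers $p,q$ interlock in $\alpha$ if their four occurrences appear in the order $p\ldots q\ldots p\ldots q$ or $q\ldots p\ldots q\ldots p$. **The sorting operation cds.** $\mathbf{cds}_{p,q}(\alpha)$ is defined only when $p$ and $q$ interlock in $\alpha$. In that case the four occurrences of $p$ and $q$ cut the list $\alpha$ into five consecutive (possibly empty) blocks of entries, $\alpha = A\,B\,C\,D\,E$, where $B$ is the block between the first and the second of these occurrences, $C$ the block between the second and third, and $D$ the block between the third and the fourth. Then $\mathbf{cds}_{p,q}(\alpha)$ is the permutation $A\,D\,C\,B\,E$, obtained by interchanging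 the blocks $B$ and $D$. **Move graph.** $\Gamma_n(\alpha)$, the move graph (overlap graph) of $\alpha$, is the graph whose vertices are the $n-1$ pointers $(i,i+1)$, $1\le i\le n-1$, with an edge $\{p,q\}$ if and only if $p$ and $q$ interlock in $\alpha$. **The graph transformation gcds.** Let $\mathcal{G}=(V,E)$ be a graph and $\{x,y\}\in E$. The master list of $\{x,y\}$ has two columns: the first consists of all neighbors of $x$ in $\mathcal{G}$ except $y$, the second of all neighbors of $y$ in $\mathcal{G}$ except $x$. The graph $\mathbf{gcds}(\mathcal{G},\{x,y\})=(V,E')$ is defined as follows. Both $x$ and $y$ are isolated in it. For $p\ne q$ in $V\setminus\{x,y\}$: (a) if $p$ or $q$ is not in the master list, then $\{p,q\}\in E'$ iff $\{p,q\}\in E$; (b) if both are in the master list, then: (b.1) if no column contains both $p$ and $q$, then $\{p,q\}\in E'$ iff $\{p,q\}\notin E$; (b.2) if some column contains both and the total number of occurrences of $p$ and $q$ in the master list (both columns together) is even, then $\{p,q\}\in E'$ iff $\{p,q\}\in E$; (b.3) if some column contains both and that total number is odd, then $\{p,q\}\in E'$ iff $\{p,q\}\notin E$. *)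

theory Defs
  imports "HOL-Combinatorics.Multiset_Permutations"
begin

type_synonym pointer = "nat \<times> nat"

definition pointers :: "nat \<Rightarrow> pointer set" where
  "pointers n = {(i, i + 1) | i. 1 \<le> i \<and> i \<le> n - 1}"

(* A permutation with its pointers written in: from left to right, every entry is
   preceded by its tail pointer and followed by its head pointer. *)

datatype symbol = Entry nat | Ptr pointer

definition decorate_entry :: "nat \<Rightarrow> nat \<Rightarrow> symbol list" where
  "decorate_entry n k =
     (if 1 < k then [Ptr (k - 1, k)] else []) @ [Entry k] @
     (if k < n then [Ptr (k, k + 1)] else [])"

definition decorate :: "nat list \<Rightarrow> symbol list" where
  "decorate \<alpha> = concat (map (decorate_entry (length \<alpha>)) \<alpha>)"

definition interlock :: "nat list \<Rightarrow> pointer \<Rightarrow> pointer \<Rightarrow> bool" where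
  "interlock \<alpha> p q \<longleftrightarrow> p \<noteq> q \<and>
     filter (\<lambda>s. s \<in> {Ptr p, Ptr q}) (decorate \<alpha>)
       \<in> {[Ptr p, Ptr q, Ptr p, Ptr q], [Ptr q, Ptr p, Ptr q, Ptr p]}"

(* The blocks of entries into which the occurrences of the pointers in S cut a
   decorated list; all other pointers are dropped. *)

fun blocks :: "pointer set \<Rightarrow> symbol list \<Rightarrow> nat list list" where
  "blocks S [] = [[]]"
| "blocks S (Entry k # xs) = (case blocks S xs of b # bs \<Rightarrow> (k # b) # bs)"
| "blocks S (Ptr r # xs) = (if r \<in> S then [] # blocks S xs else blocks S xs)"

definition cds :: "pointer \<Rightarrow> pointer \<Rightarrow> nat list \<Rightarrow> nat list" where
  "cds p q \<alpha> =
     (if interlock \<alpha> p q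
      then (case blocks {p, q} (decorate \<alpha>) of [A, B, C, D, E] \<Rightarrow> A @ D @ C @ B @ E)
      else undefined)"

(* A graph is a pair (V, E) whose edges are two-element sets of vertices; the type does
   not enforce this. *)

type_synonym 'v graph = "'v set \<times> 'v set set"

definition move_graph :: "nat \<Rightarrow> nat list \<Rightarrow> pointer graph" where
  "move_graph n \<alpha> =
     (pointers n, {{p, q} | p q. p \<in> pointers n \<and> q \<in> pointers n \<and> interlock \<alpha> p q})"

(* The master list of an edge e = {x, y} is given by its two columns, indexed by the
   ends of e: the column of an end z lists the neighbours of z other than the other end. *)

definition column :: "'v graph \<Rightarrow> 'v set \<Rightarrow> 'v \<Rightarrow> 'v set" where
  "column G e z = {v. {z, v} \<in> snd G} - (e - {z})"

definition master_list :: "'v graph \<Rightarrow> 'v set \<Rightarrow> 'v set" where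
  "master_list G e = (\<Union>z\<in>e. column G e z)"

definition occurrences :: "'v graph \<Rightarrow> 'v set \<Rightarrow> 'v \<Rightarrow> nat" where
  "occurrences G e p = card {z \<in> e. p \<in> column G e z}"

definition gcds_edge :: "'v graph \<Rightarrow> 'v set \<Rightarrow> 'v \<Rightarrow> 'v \<Rightarrow> bool" where
  "gcds_edge G e p q \<longleftrightarrow>
     (if p \<notin> master_list G e \<or> q \<notin> master_list G e then {p, q} \<in> snd G
      else if \<not> (\<exists>z\<in>e. p \<in> column G e z \<and> q \<in> column G e z) then {p, q} \<notin> snd G
      else if even (occurrences G e p + occurrences G e q) then {p, q} \<in> snd G
      else {p, q} \<notin> snd G)"

definition gcds :: "'v graph \<Rightarrow> 'v set \<Rightarrow> 'v graph" where
  "gcds G e =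
     (fst G, {{p, q} | p q. p \<in> fst G - e \<and> q \<in> fst G - e \<and> p \<noteq> q \<and> gcds_edge G e p q})"

end

(*
  Two pointers that both occur twice interlock iff the number of pairs consisting of an
  occurrence of the first one that precedes an occurrence of the second one is odd.  This
  number is additive under concatenation up to a product of occurrence counts, so with the
  decorated list cut as A p B q C p D q E, the effect of interchanging B and D on the parity
  for r and s is [r~p][s~q] + [r~q][s~p] modulo 2.  The case distinction of gcds computes
  exactly this correction term.  The pointers p and q become isolated because their two
  occurrences become adjacent: if p = (i, i + 1), then cds makes i + 1 the successor of i.
*)
theory Submission
  imports Defs
begin

section \<open>Counting pairs of occurrences\<close>

fun pairs :: "'a \<Rightarrow> 'a \<Rightarrow> 'a list \<Rightarrow> nat" where
  "pairs x y [] = 0"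
| "pairs x y (z # zs) = (if z = x then count_list zs y else 0) + pairs x y zs"

lemma pairs_append:
  "pairs x y (xs @ ys) = pairs x y xs + pairs x y ys + count_list xs x * count_list ys y"
  by (induction xs) auto

lemma count_list_filter: "P x \<Longrightarrow> count_list (filter P xs) x = count_list xs x"
  by (induction xs) auto

lemma pairs_filter: "P x \<Longrightarrow> P y \<Longrightarrow> pairs x y (filter P xs) = pairs x y xs"
  by (induction xs) (auto simp: count_list_filter)

lemma pairs_notin: "x \<notin> set xs \<Longrightarrow> pairs x y xs = 0"
  by (induction xs) auto

lemma length_two_letters:
  "x \<noteq> y \<Longrightarrow> set xs \<subseteq> {x, y} \<Longrightarrow> length xs = count_list xs x + count_list xs y"
  by (induction xs) auto

text \<open>Of the six words with two letters \<open>x\<close> and two letters \<open>y\<close>,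
  \<open>xyxy\<close> and \<open>yxyx\<close> give 3 and 1 pairs, while \<open>xxyy\<close>,
  \<open>xyyx\<close>, \<open>yxxy\<close> and \<open>yyxx\<close> give 4, 2, 2 and 0.\<close>

lemma alternating_iff_odd_pairs:
  assumes "x \<noteq> y" "count_list xs x = 2" "count_list xs y = 2"
  shows "filter (\<lambda>z. z \<in> {x, y}) xs \<in> {[x, y, x, y], [y, x, y, x]} \<longleftrightarrow> odd (pairs x y xs)"
proof -
  define ys where "ys = filter (\<lambda>z. z \<in> {x, y}) xs"
  have cx: "count_list ys x = 2" and cy: "count_list ys y = 2"
    and pairs: "pairs x y ys = pairs x y xs" and sub: "set ys \<subseteq> {x, y}"
    using assms by (auto simp: ys_def count_list_filter pairs_filter)
  have "length ys = 4"
    using length_two_letters[OF assms(1) sub] cx cy by simp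
  then obtain a b c d where ys: "ys = [a, b, c, d]"
    by (auto simp: numeral_eq_Suc length_Suc_conv)
  have "a \<in> {x, y}" "b \<in> {x, y}" "c \<in> {x, y}" "d \<in> {x, y}"
    using sub by (auto simp: ys)
  then have "ys \<in> {[x, y, x, y], [y, x, y, x]} \<longleftrightarrow> odd (pairs x y ys)"
    using assms(1) cx cy unfolding ys by (elim insertE emptyE) auto
  then show ?thesis
    unfolding pairs unfolding ys_def .
qed

text \<open>Only pairs across two different blocks among \<open>B\<close>, \<open>C\<close>,
  \<open>D\<close> depend on the interchange. The two orders together contribute each of the six
  mixed products of counts once. The correction term expands to the same six products plus twice the
  product of the counts of \<open>r\<close> and \<open>s\<close> in \<open>C\<close>.\<close>

lemma odd_pairs_interchange:
  fixes A B C D E :: "'a list" and x y :: 'a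
  defines "L \<equiv> A @ x # B @ y # C @ x # D @ y # E"
  assumes "x \<noteq> y" "r \<notin> {x, y}" "s \<notin> {x, y}"
    and "\<And>z. z \<in> {x, y} \<Longrightarrow> z \<notin> set (A @ B @ C @ D @ E)"
  shows "odd (pairs r s (A @ D @ C @ B @ E)) \<longleftrightarrow>
    odd (pairs r s L) \<noteq>
      ((odd (pairs x r L) \<and> odd (pairs y s L)) \<noteq> (odd (pairs y r L) \<and> odd (pairs x s L)))"
proof -
  have notin: "x \<notin> set A" "x \<notin> set B" "x \<notin> set C" "x \<notin> set D" "x \<notin> set E"
    "y \<notin> set A" "y \<notin> set B" "y \<notin> set C" "y \<notin> set D" "y \<notin> set E"
    using assms(5) by auto
  \<comment> \<open>\<open>x\<close> stands before \<open>B\<close> and before \<open>D\<close>, so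
    letters in \<open>D\<close> and \<open>E\<close> are counted twice and drop out modulo 2;
    likewise \<open>E\<close> for \<open>y\<close>.\<close>
  have x: "odd (pairs x z L) \<longleftrightarrow> odd (count_list B z + count_list C z)"
    and y: "odd (pairs y z L) \<longleftrightarrow> odd (count_list C z + count_list D z)"
    if "z \<notin> {x, y}" for z
    using that notin assms(2) by (auto simp: L_def pairs_append pairs_notin)
  let ?r = "\<lambda>X. count_list X r" and ?s = "\<lambda>X. count_list X s" and ?p = "pairs r s"
  have "?p (A @ D @ C @ B @ E) + ?p L +
      ((?r B + ?r C) * (?s C + ?s D) + (?r C + ?r D) * (?s B + ?s C)) =
    2 * (?p A + ?p B + ?p C + ?p D + ?p E + ?r A * (?s B + ?s C + ?s D + ?s E) +
      (?r B + ?r C + ?r D) * ?s E + ?r B * (?s C + ?s D) + ?r C * (?s B + ?s C + ?s D) +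
      ?r D * (?s B + ?s C))"
    using assms(3,4) by (auto simp: L_def pairs_append algebra_simps)
  then have "even (?p (A @ D @ C @ B @ E) + ?p L +
      ((?r B + ?r C) * (?s C + ?s D) + (?r C + ?r D) * (?s B + ?s C)))"
    by simp
  then show ?thesis
    unfolding x[OF assms(3)] x[OF assms(4)] y[OF assms(3)] y[OF assms(4)] even_mult_iff
      even_add[of "_ * _"] even_add[of "pairs _ _ _"] even_add[of "pairs _ _ _ + _"]
    by blast
qed

section \<open>Cutting decorated lists\<close>

text \<open>\<open>decorate\<close> takes the bound from the length of its argument and so does not
  distribute over append. With \<open>n\<close> fixed, blocks can be decorated separately.\<close>

abbreviation decorate_in :: "nat \<Rightarrow> nat list \<Rightarrow> symbol list" where
  "decorate_in n xs \<equiv> concat (map (decorate_entry n) xs)"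

fun entries :: "symbol list \<Rightarrow> nat list" where
  "entries [] = []"
| "entries (Entry k # xs) = k # entries xs"
| "entries (Ptr r # xs) = entries xs"

lemma entries_append: "entries (xs @ ys) = entries xs @ entries ys"
  by (induction xs rule: entries.induct) auto

lemma entries_decorate_in: "entries (decorate_in n xs) = xs"
  by (induction xs) (auto simp: decorate_entry_def entries_append)

lemma blocks_no_pointer: "(\<And>r. r \<in> S \<Longrightarrow> Ptr r \<notin> set u) \<Longrightarrow> blocks S u = [entries u]"
  by (induction u rule: entries.induct) auto

lemma blocks_cut:
  "(\<And>r. r \<in> S \<Longrightarrow> Ptr r \<notin> set u) \<Longrightarrow> r \<in> S \<Longrightarrow>
    blocks S (u @ Ptr r # v) = entries u # blocks S v"
  by (induction u rule: entries.induct) auto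

text \<open>Serves to find the entry \<open>k\<close> to whose decoration a given occurrence of a
  pointer belongs.\<close>

lemma concat_map_eq_append_Cons:
  assumes "concat (map f xs) = u @ z # v"
  obtains xs1 k xs2 u' v' where "xs = xs1 @ k # xs2" "f k = u' @ z # v'"
    "u = concat (map f xs1) @ u'" "v = v' @ concat (map f xs2)"
  using assms
proof (induction xs arbitrary: u thesis)
  case Nil
  then show ?case by simp
next
  case (Cons a xs)
  from Cons.prems(2) have "f a @ concat (map f xs) = u @ z # v"
    by simp
  then consider (inside) us where "f a = u @ us" "us @ concat (map f xs) = z # v"
    | (later) us where "u = f a @ us" "concat (map f xs) = us @ z # v"
    by (auto simp: append_eq_append_conv2)
  then show ?case
  proof cases
    case later
    then obtain xs1 k xs2 u' v' where "xs = xs1 @ k # xs2" "f k = u' @ z # v'"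
      "us = concat (map f xs1) @ u'" "v = v' @ concat (map f xs2)"
      using Cons.IH by metis
    then show ?thesis
      using later Cons.prems(1)[of "a # xs1" k xs2 u' v'] by simp
  next
    case inside
    show ?thesis
    proof (cases us)
      case (Cons c us')
      then show ?thesis
        using inside Cons.prems(1)[of "[]" a xs u us'] by simp
    next
      \<comment> \<open>The cut falls exactly at the end of \<open>f a\<close>, so \<open>z\<close>
        starts the rest and the induction hypothesis applies with an empty prefix.\<close>
      case Nil
      then have "concat (map f xs) = [] @ z # v" and u: "u = f a"
        using inside by auto
      then obtain xs1 k xs2 u' v' where "xs = xs1 @ k # xs2" "f k = u' @ z # v'"
        "[] = concat (map f xs1) @ u'" "v = v' @ concat (map f xs2)"
        using Cons.IH by metis
      then show ?thesis
        using u Cons.prems(1)[of "a # xs1" k xs2 u' v'] by simp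
    qed
  qed
qed

text \<open>A cut at a tail pointer leaves no part of its entry on the left. A cut at a head pointer
  leaves the entry there, and decorating again restores only the removed \<open>r\<close>, which
  \<open>P\<close> discards.\<close>

lemma decorate_in_cut:
  assumes "decorate_in n xs = u @ Ptr r # v"
  shows "(\<exists>u'. u = u' @ [Entry (fst r)]) \<or> (\<exists>v'. v = Entry (snd r) # v')"
    and "\<not> P (Ptr r) \<Longrightarrow> filter P (decorate_in n (entries u)) = filter P u"
proof -
  obtain xs1 k xs2 u' v' where k: "xs = xs1 @ k # xs2" "decorate_entry n k = u' @ Ptr r # v'"
    "u = decorate_in n xs1 @ u'" "v = v' @ decorate_in n xs2"
    using concat_map_eq_append_Cons[OF assms] .
  have cases: "u' = [] \<and> r = (k - 1, k) \<and> (\<exists>w. v' = Entry k # w) \<or>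
      u' = (if 1 < k then [Ptr (k - 1, k)] else []) @ [Entry k] \<and> v' = [] \<and> r = (k, k + 1)"
    using k(2)
    by (auto simp: decorate_entry_def Cons_eq_append_conv append_eq_Cons_conv split: if_splits)
  then show "(\<exists>u'. u = u' @ [Entry (fst r)]) \<or> (\<exists>v'. v = Entry (snd r) # v')"
    using k by auto
  assume "\<not> P (Ptr r)"
  moreover have "entries u = xs1 @ entries u'"
    using k(3) by (simp add: entries_append entries_decorate_in)
  ultimately show "filter P (decorate_in n (entries u)) = filter P u"
    using cases k(3) by (auto simp: decorate_entry_def)
qed

section \<open>Occurrences of pointers in permutations\<close>

lemma count_list_concat_map:
  "count_list (concat (map f xs)) z = sum_list (map (\<lambda>k. count_list (f k) z) xs)"
  by (induction xs) auto

lemma length_permutation: "\<alpha> \<in> permutations_of_set {1..n} \<Longrightarrow> length \<alpha> = n"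
  by (metis permutations_of_setD distinct_card card_atLeastAtMost diff_Suc_1)

lemma decorate_permutation:
  "\<alpha> \<in> permutations_of_set {1..n} \<Longrightarrow> decorate \<alpha> = decorate_in n \<alpha>"
  by (simp add: decorate_def length_permutation)

lemma count_decorate:
  assumes "\<alpha> \<in> permutations_of_set {1..n}" "r \<in> pointers n"
  shows "count_list (decorate \<alpha>) (Ptr r) = 2"
proof -
  obtain i where i: "r = (i, i + 1)" "1 \<le> i" "i + 1 \<le> n"
    using assms(2) by (auto simp: pointers_def)
  have "count_list (decorate \<alpha>) (Ptr r) = (\<Sum>k\<in>{1..n}. count_list (decorate_entry n k) (Ptr r))"
    using permutations_of_setD[OF assms(1)]
    by (simp add: decorate_permutation[OF assms(1)] count_list_concat_map
        sum_list_distinct_conv_sum_set)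
  \<comment> \<open>The pointer occurs once as head of \<open>i\<close> and once as tail of
    \<open>i + 1\<close>.\<close>
  also have "\<dots> = (\<Sum>k\<in>{1..n}. (if k = i then 1 else 0) + (if k = i + 1 then 1 else 0))"
    using i by (intro sum.cong) (auto simp: decorate_entry_def)
  also have "\<dots> = 2"
    using i by (simp add: sum.distrib)
  finally show ?thesis .
qed

lemma interlock_commute: "interlock \<alpha> p q \<longleftrightarrow> interlock \<alpha> q p"
  by (auto simp: interlock_def insert_commute)

lemma interlock_iff_odd_pairs:
  assumes "\<alpha> \<in> permutations_of_set {1..n}" "r \<in> pointers n" "s \<in> pointers n"
  shows "interlock \<alpha> r s \<longleftrightarrow> r \<noteq> s \<and> odd (pairs (Ptr r) (Ptr s) (decorate \<alpha>))"
  using alternating_iff_odd_pairs[of "Ptr r" "Ptr s" "decorate \<alpha>"] assms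
  by (auto simp: interlock_def count_decorate)

text \<open>The head pointer of \<open>i\<close> directly precedes the tail pointer of
  \<open>i + 1\<close>, so every occurrence of \<open>s\<close> comes after both or after neither,
  and the number of pairs is even.\<close>

lemma adjacent_not_interlock:
  assumes "\<alpha> \<in> permutations_of_set {1..n}" "(i, i + 1) \<in> pointers n" "s \<in> pointers n"
    and "\<alpha> = U @ [i, i + 1] @ V"
  shows "\<not> interlock \<alpha> (i, i + 1) s"
proof
  assume "interlock \<alpha> (i, i + 1) s"
  then have ne: "s \<noteq> (i, i + 1)" and odd: "odd (pairs (Ptr (i, i + 1)) (Ptr s) (decorate \<alpha>))"
    using interlock_iff_odd_pairs[OF assms(1-3)] by auto
  let ?p = "Ptr (i, i + 1)"
  have "decorate_in n (U @ [i, i + 1] @ V) =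
      (decorate_in n U @ (if 1 < i then [Ptr (i - 1, i)] else []) @ [Entry i]) @ [?p, ?p] @
      (Entry (i + 1) # (if i + 1 < n then [Ptr (i + 1, i + 2)] else []) @ decorate_in n V)"
    using assms(2) by (auto simp: decorate_entry_def pointers_def)
  then obtain u v where uv: "decorate \<alpha> = u @ [?p, ?p] @ v"
    using decorate_permutation[OF assms(1)] assms(4) by metis
  have "count_list u ?p + 2 + count_list v ?p = 2"
    using count_decorate[OF assms(1,2)] by (simp add: uv)
  then have "?p \<notin> set u" "?p \<notin> set v"
    by (auto simp: count_list_0_iff)
  then have "even (pairs ?p (Ptr s) (decorate \<alpha>))"
    using ne by (auto simp: uv pairs_append pairs_notin)
  with odd show False by simp
qed

section \<open>The effect of cds on interlocking\<close>

lemma cds_commute: "cds p q \<alpha> = cds q p \<alpha>"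
  by (simp add: cds_def interlock_commute[of \<alpha> p q] insert_commute)

lemma filter_eq_four:
  assumes "filter P xs = [w, x, y, z]"
  obtains A B C D E where "xs = A @ w # B @ x # C @ y # D @ z # E"
    "\<And>a. P a \<Longrightarrow> a \<notin> set (A @ B @ C @ D @ E)"
proof -
  obtain A xs1 where 1: "xs = A @ w # xs1" "\<forall>a\<in>set A. \<not> P a" "filter P xs1 = [x, y, z]"
    using filter_eq_ConsD[OF assms] by (metis (no_types))
  obtain B xs2 where 2: "xs1 = B @ x # xs2" "\<forall>a\<in>set B. \<not> P a" "filter P xs2 = [y, z]"
    using filter_eq_ConsD[OF 1(3)] by (metis (no_types))
  obtain C xs3 where 3: "xs2 = C @ y # xs3" "\<forall>a\<in>set C. \<not> P a" "filter P xs3 = [z]"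
    using filter_eq_ConsD[OF 2(3)] by (metis (no_types))
  obtain D E where 4: "xs3 = D @ z # E" "\<forall>a\<in>set D. \<not> P a" "\<forall>a\<in>set E. \<not> P a"
    using filter_eq_ConsD[OF 3(3)] by (metis (no_types) filter_empty_conv)
  show thesis
    using 1(1,2) 2(1,2) 3(1,2) 4 by (intro that[of A B C D E]) auto
qed

text \<open>If \<open>r\<close> or \<open>s\<close> is among \<open>p\<close>, \<open>q\<close>,
  both sides are false because \<open>cds\<close> isolates these pointers. Otherwise deleting
  \<open>p\<close> and \<open>q\<close> from the decorated lists leaves the pair counts of
  \<open>r\<close> and \<open>s\<close> unchanged, and \<open>odd_pairs_interchange\<close>
  applies.\<close>

lemma interlock_cds_ordered:
  assumes \<alpha>: "\<alpha> \<in> permutations_of_set {1..n}"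
    and p: "p \<in> pointers n" and q: "q \<in> pointers n" and ne: "p \<noteq> q"
    and order: "filter (\<lambda>s. s \<in> {Ptr p, Ptr q}) (decorate \<alpha>) = [Ptr p, Ptr q, Ptr p, Ptr q]"
    and r: "r \<in> pointers n" and s: "s \<in> pointers n"
  shows "interlock (cds p q \<alpha>) r s \<longleftrightarrow> r \<notin> {p, q} \<and> s \<notin> {p, q} \<and> r \<noteq> s \<and>
    interlock \<alpha> r s \<noteq>
      ((interlock \<alpha> p r \<and> interlock \<alpha> q s) \<noteq> (interlock \<alpha> q r \<and> interlock \<alpha> p s))"
proof -
  obtain A B C D E where dec: "decorate \<alpha> = A @ Ptr p # B @ Ptr q # C @ Ptr p # D @ Ptr q # E"
    and notin: "\<And>a. a \<in> {Ptr p, Ptr q} \<Longrightarrow> a \<notin> set (A @ B @ C @ D @ E)"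
    using filter_eq_four[OF order] by metis
  let ?A = "entries A" and ?B = "entries B" and ?C = "entries C" and ?D = "entries D"
    and ?E = "entries E"
  define \<beta> where "\<beta> = ?A @ ?D @ ?C @ ?B @ ?E"
  have free: "Ptr t \<notin> set A" "Ptr t \<notin> set B" "Ptr t \<notin> set C" "Ptr t \<notin> set D" "Ptr t \<notin> set E"
    if "t \<in> {p, q}" for t
    using that notin by auto
  have "blocks {p, q} (decorate \<alpha>) = [?A, ?B, ?C, ?D, ?E]"
    unfolding dec using blocks_cut[of "{p, q}", OF free(1)] blocks_cut[of "{p, q}", OF free(2)]
      blocks_cut[of "{p, q}", OF free(3)] blocks_cut[of "{p, q}", OF free(4)]
      blocks_no_pointer[of "{p, q}", OF free(5)]
    by simp
  moreover have "interlock \<alpha> p q"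
    using order ne by (simp add: interlock_def)
  ultimately have cds: "cds p q \<alpha> = \<beta>"
    by (simp add: cds_def \<beta>_def)

  have dec_in: "decorate_in n \<alpha> = A @ Ptr p # B @ Ptr q # C @ Ptr p # D @ Ptr q # E"
    using dec by (simp add: decorate_permutation[OF \<alpha>])
  then have \<alpha>_eq: "\<alpha> = ?A @ ?B @ ?C @ ?D @ ?E"
    using entries_decorate_in[of n \<alpha>] by (simp add: entries_append)
  have \<alpha>D: "set \<alpha> = {1..n}" "distinct \<alpha>"
    using permutations_of_setD[OF \<alpha>] by auto
  have \<beta>: "\<beta> \<in> permutations_of_set {1..n}"
    using \<alpha>D by (auto simp: \<alpha>_eq \<beta>_def permutations_of_set_def)

  \<comment> \<open>Decorating a block of entries on its own may restore \<open>p\<close> or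
    \<open>q\<close> at its ends, so the blocks of symbols are recovered only up to these two
    pointers.\<close>
  let ?P = "\<lambda>a. a \<notin> {Ptr p, Ptr q}"
  have fil: "filter ?P A = A" "filter ?P B = B" "filter ?P C = C" "filter ?P D = D"
    "filter ?P E = E"
    using notin by (auto simp: filter_id_conv)
  note cuts = decorate_in_cut[OF dec_in]
    decorate_in_cut[of n \<alpha> "A @ Ptr p # B" q "C @ Ptr p # D @ Ptr q # E"]
    decorate_in_cut[of n \<alpha> "A @ Ptr p # B @ Ptr q # C" p "D @ Ptr q # E"]
    decorate_in_cut[of n \<alpha> "A @ Ptr p # B @ Ptr q # C @ Ptr p # D" q E]
  have dA: "filter ?P (decorate_in n ?A) = A"
    using cuts(2)[of ?P] fil by simp
  \<comment> \<open>Each cut describes the whole prefix before it; the blocks already known are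
    cancelled.\<close>
  have dB: "filter ?P (decorate_in n ?B) = B"
    using cuts(4)[of ?P] fil dec_in dA by (simp add: entries_append)
  have dC: "filter ?P (decorate_in n ?C) = C"
    using cuts(6)[of ?P] fil dec_in dA dB by (simp add: entries_append)
  have dD: "filter ?P (decorate_in n ?D) = D"
    using cuts(8)[of ?P] fil dec_in dA dB dC by (simp add: entries_append)
  have dE: "filter ?P (decorate_in n ?E) = E"
  proof -
    \<comment> \<open>No cut follows \<open>E\<close>, so the whole list is used instead of a
      prefix.\<close>
    have "filter ?P (decorate_in n (?A @ ?B @ ?C @ ?D @ ?E)) = A @ B @ C @ D @ E"
      using fil dec_in by (simp flip: \<alpha>_eq)
    then show ?thesis using dA dB dC dD by simp
  qed
  have d\<beta>: "filter ?P (decorate \<beta>) = A @ D @ C @ B @ E"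
    using dA dB dC dD dE unfolding decorate_permutation[OF \<beta>] by (simp add: \<beta>_def)

  have iso: "\<not> interlock \<beta> t z" if "t \<in> {p, q}" "z \<in> pointers n" for t z
  proof -
    obtain i j where i: "p = (i, i + 1)" and j: "q = (j, j + 1)"
      using p q by (auto simp: pointers_def)
    have p1: "(\<exists>u. A = u @ [Entry i]) \<or> (\<exists>v. B = Entry (i + 1) # v)"
      using cuts(1) by (auto simp: i Cons_eq_append_conv append_eq_Cons_conv)
    have q1: "(\<exists>u. B = u @ [Entry j]) \<or> (\<exists>v. C = Entry (j + 1) # v)"
      using cuts(3) dec_in
      \<comment> \<open>If \<open>B\<close> is empty, the symbol before the cut is a pointer, which
        rules out the first alternative.\<close>
      by (cases B rule: rev_cases) (auto simp: j Cons_eq_append_conv append_eq_Cons_conv)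
    have p2: "(\<exists>u. C = u @ [Entry i]) \<or> (\<exists>v. D = Entry (i + 1) # v)"
      using cuts(5) dec_in
      by (cases C rule: rev_cases) (auto simp: i Cons_eq_append_conv append_eq_Cons_conv)
    have q2: "(\<exists>u. D = u @ [Entry j]) \<or> (\<exists>v. E = Entry (j + 1) # v)"
      using cuts(7) dec_in
      by (cases D rule: rev_cases) (auto simp: j Cons_eq_append_conv append_eq_Cons_conv)
    have dist: "distinct (?A @ ?B @ ?C @ ?D @ ?E)"
      using \<alpha>D by (simp flip: \<alpha>_eq)
    have "\<exists>U V. \<beta> = U @ [i, i + 1] @ V"
    proof -
      \<comment> \<open>The other two combinations would make \<open>i\<close> end two blocks or
        \<open>i + 1\<close> begin two blocks, against distinctness. In both remaining cases the two
        blocks become neighbours in \<beta>.\<close>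
      consider u v where "A = u @ [Entry i]" "D = Entry (i + 1) # v"
        | u v where "C = u @ [Entry i]" "B = Entry (i + 1) # v"
        using p1 p2 dist by (auto simp: entries_append)
      then show ?thesis
      proof cases
        case 1
        then show ?thesis
          unfolding \<beta>_def
          by (intro exI[of _ "entries u"] exI[of _ "entries v @ ?C @ ?B @ ?E"])
            (simp add: entries_append)
      next
        case 2
        then show ?thesis
          unfolding \<beta>_def
          by (intro exI[of _ "?A @ ?D @ entries u"] exI[of _ "entries v @ ?E"])
            (simp add: entries_append)
      qed
    qed
    moreover have "\<exists>U V. \<beta> = U @ [j, j + 1] @ V"
    proof -
      consider u v where "B = u @ [Entry j]" "E = Entry (j + 1) # v"
        | u v where "D = u @ [Entry j]" "C = Entry (j + 1) # v"
        using q1 q2 dist by (auto simp: entries_append)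
      then show ?thesis
      proof cases
        case 1
        then show ?thesis
          unfolding \<beta>_def
          by (intro exI[of _ "?A @ ?D @ ?C @ entries u"] exI[of _ "entries v"])
            (simp add: entries_append)
      next
        case 2
        then show ?thesis
          unfolding \<beta>_def
          by (intro exI[of _ "?A @ entries u"] exI[of _ "entries v @ ?B @ ?E"])
            (simp add: entries_append)
      qed
    qed
    ultimately show ?thesis
      using that adjacent_not_interlock[OF \<beta>] p q unfolding i j by blast
  qed

  show ?thesis
  proof (cases "r \<in> {p, q} \<or> s \<in> {p, q}")
    case True
    then have "\<not> interlock \<beta> r s"
      using iso r s interlock_commute by blast
    then show ?thesis
      using True unfolding cds by blast
  next
    case False
    then have rs: "r \<notin> {p, q}" "s \<notin> {p, q}" by auto
    have "pairs (Ptr r) (Ptr s) (decorate \<beta>) = pairs (Ptr r) (Ptr s) (A @ D @ C @ B @ E)"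
      using rs pairs_filter[of ?P "Ptr r" "Ptr s" "decorate \<beta>"] unfolding d\<beta> by simp
    then have "odd (pairs (Ptr r) (Ptr s) (decorate \<beta>)) \<longleftrightarrow>
        odd (pairs (Ptr r) (Ptr s) (decorate \<alpha>)) \<noteq>
          ((odd (pairs (Ptr p) (Ptr r) (decorate \<alpha>)) \<and> odd (pairs (Ptr q) (Ptr s) (decorate \<alpha>))) \<noteq>
           (odd (pairs (Ptr q) (Ptr r) (decorate \<alpha>)) \<and> odd (pairs (Ptr p) (Ptr s) (decorate \<alpha>))))"
      using rs ne notin
        odd_pairs_interchange[of "Ptr p" "Ptr q" "Ptr r" "Ptr s" A B C D E, folded dec]
      by simp
    moreover have "p \<noteq> r" "p \<noteq> s" "q \<noteq> r" "q \<noteq> s"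
      using rs by auto
    ultimately show ?thesis
      using rs
      by (cases "r = s")
        (simp_all add: cds interlock_iff_odd_pairs[OF \<alpha>] interlock_iff_odd_pairs[OF \<beta>] p q r s)
  qed
qed

lemma interlock_cds:
  assumes "\<alpha> \<in> permutations_of_set {1..n}"
    and "p \<in> pointers n" "q \<in> pointers n" "interlock \<alpha> p q"
    and "r \<in> pointers n" "s \<in> pointers n"
  shows "interlock (cds p q \<alpha>) r s \<longleftrightarrow> r \<notin> {p, q} \<and> s \<notin> {p, q} \<and> r \<noteq> s \<and>
    interlock \<alpha> r s \<noteq>
      ((interlock \<alpha> p r \<and> interlock \<alpha> q s) \<noteq> (interlock \<alpha> q r \<and> interlock \<alpha> p s))"
proof -
  have ne: "p \<noteq> q" and "filter (\<lambda>s. s \<in> {Ptr p, Ptr q}) (decorate \<alpha>)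
      \<in> {[Ptr p, Ptr q, Ptr p, Ptr q], [Ptr q, Ptr p, Ptr q, Ptr p]}"
    using assms(4) by (auto simp: interlock_def)
  then consider
      "filter (\<lambda>s. s \<in> {Ptr p, Ptr q}) (decorate \<alpha>) = [Ptr p, Ptr q, Ptr p, Ptr q]"
    \<comment> \<open>Written with \<open>q\<close> first, this is the ordered case with
      \<open>p\<close> and \<open>q\<close> exchanged; the correction term is symmetric in
      them.\<close>
    | "filter (\<lambda>s. s \<in> {Ptr q, Ptr p}) (decorate \<alpha>) = [Ptr q, Ptr p, Ptr q, Ptr p]"
    by (auto simp: insert_commute)
  then show ?thesis
  proof cases
    case 1
    then show ?thesis
      using interlock_cds_ordered[OF assms(1-3) ne _ assms(5,6)] by blast
  next
    case 2
    then show ?thesis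
      using interlock_cds_ordered[OF assms(1,3,2) ne[symmetric] _ assms(5,6)]
      unfolding cds_commute[of p q] by blast
  qed
qed

section \<open>The graph transformation\<close>

lemma move_graph_edge:
  "{r, s} \<in> snd (move_graph n \<alpha>) \<longleftrightarrow> r \<in> pointers n \<and> s \<in> pointers n \<and> interlock \<alpha> r s"
  by (simp add: move_graph_def doubleton_eq_iff del: split_paired_Ex) (use interlock_commute in blast)

text \<open>Assign to \<open>r\<close> and \<open>s\<close> the 0-1 vectors recording their
  interlocking with \<open>p\<close> and \<open>q\<close>. The correction is the determinant of
  these vectors over the field with two elements, which is 1 iff they are nonzero and distinct. A
  vertex outside the master list has the zero vector; two vectors with a common column are equal iff
  the total number of occurrences is even.\<close>

lemma gcds_edge_move_graph:
  assumes "p \<in> pointers n" "q \<in> pointers n" "p \<noteq> q"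
    and "r \<in> pointers n - {p, q}" "s \<in> pointers n - {p, q}"
  shows "gcds_edge (move_graph n \<alpha>) {p, q} r s \<longleftrightarrow>
    interlock \<alpha> r s \<noteq>
      ((interlock \<alpha> p r \<and> interlock \<alpha> q s) \<noteq> (interlock \<alpha> q r \<and> interlock \<alpha> p s))"
proof -
  let ?G = "move_graph n \<alpha>"
  have column: "t \<in> column ?G {p, q} z \<longleftrightarrow> interlock \<alpha> z t"
    if "z \<in> {p, q}" "t \<in> pointers n - {p, q}" for z t
    using that assms(1,2) by (auto simp: column_def move_graph_edge)
  have master: "t \<in> master_list ?G {p, q} \<longleftrightarrow> interlock \<alpha> p t \<or> interlock \<alpha> q t"
    and occ: "occurrences ?G {p, q} t = of_bool (interlock \<alpha> p t) + of_bool (interlock \<alpha> q t)"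
    if t: "t \<in> pointers n - {p, q}" for t
  proof -
    show "t \<in> master_list ?G {p, q} \<longleftrightarrow> interlock \<alpha> p t \<or> interlock \<alpha> q t"
      using column[OF _ t] by (auto simp: master_list_def)
    have "{z \<in> {p, q}. t \<in> column ?G {p, q} z} =
        (if interlock \<alpha> p t then {p} else {}) \<union> (if interlock \<alpha> q t then {q} else {})"
      using column[OF _ t] by auto
    then show "occurrences ?G {p, q} t = of_bool (interlock \<alpha> p t) + of_bool (interlock \<alpha> q t)"
      using assms(3) by (auto simp: occurrences_def)
  qed
  have common: "(\<exists>z\<in>{p, q}. r \<in> column ?G {p, q} z \<and> s \<in> column ?G {p, q} z) \<longleftrightarrow>
      (interlock \<alpha> p r \<and> interlock \<alpha> p s) \<or> (interlock \<alpha> q r \<and> interlock \<alpha> q s)"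
    using column[OF _ assms(4)] column[OF _ assms(5)] by auto
  have edge: "{r, s} \<in> snd ?G \<longleftrightarrow> interlock \<alpha> r s"
    using assms(4,5) by (simp add: move_graph_edge)
  show ?thesis
    unfolding gcds_edge_def master[OF assms(4)] master[OF assms(5)] occ[OF assms(4)]
      occ[OF assms(5)] common edge
    by auto
qed

theorem theorem2:
  fixes n :: nat and \<alpha> :: "nat list" and p q :: pointer
  assumes "n \<ge> 1"
    and "\<alpha> \<in> permutations_of_set {1..n}"
    and "p \<in> pointers n" and "q \<in> pointers n"
    and "interlock \<alpha> p q"
  shows "move_graph n (cds p q \<alpha>) = gcds (move_graph n \<alpha>) {p, q}"
proof -
  have ne: "p \<noteq> q"
    using assms(5) by (simp add: interlock_def)
  \<comment> \<open>Both edge sets collect doubletons over ordered pairs, so it suffices to compare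
    the conditions pair by pair.\<close>
  have "r \<in> pointers n \<and> s \<in> pointers n \<and> interlock (cds p q \<alpha>) r s \<longleftrightarrow>
      r \<in> pointers n - {p, q} \<and> s \<in> pointers n - {p, q} \<and> r \<noteq> s \<and>
      gcds_edge (move_graph n \<alpha>) {p, q} r s" for r s
    using interlock_cds[OF assms(2-5), of r s] gcds_edge_move_graph[OF assms(3,4) ne, of r s \<alpha>]
    by blast
  then show ?thesis
    by (simp add: move_graph_def gcds_def)
qed

end
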